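(* Let $G$ be a finite abelian group of order $n\ge 2$. If $G$ is isomorphic to an elementary abelian $p$-group for $p=2$ or $p=3$, then $s(G,3)=0$. Otherwise $$\frac{1}{9}n \le s(G,3)\le \frac{1}{4}n.$$
   Context: $G$ is written additively. A subset $A=\{a_1,\dots,a_m\}$ (with $m\ge1$) of $G$ is called $t$-independent if whenever $\lambda_1a_1+\cdots+\lambda_ma_m=0$ for integers $\lambda_i$ with $\sum|\lambda_i|\le t$, we have all $\lambda_i=0$. $s(G,t)$ denotes the largest size of a $t$-independent subset of $G$ ($0$ if there is none). *)

theory Defs
  imports Complex_Main "HOL-Algebra.Algebra"
begin

text \<open>
  Groups use the multiplicative notation of HOL-Algebra, so the linear combination
  \<open>\<lambda>\<^sub>1 a\<^sub>1 + \<dots> + \<lambda>\<^sub>m a\<^sub>m\<close> of the elements of a finite set \<open>A\<close> becomes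
  \<open>\<Otimes>a\<in>A. a [^] c a\<close>, with an integer coefficient \<open>c a\<close> for each \<open>a \<in> A\<close>.
\<close>

definition t_independent :: "('a, 'b) monoid_scheme \<Rightarrow> nat \<Rightarrow> 'a set \<Rightarrow> bool" where
  "t_independent G t A \<longleftrightarrow>
     A \<subseteq> carrier G \<and> finite A \<and> A \<noteq> {} \<and>
     (\<forall>c :: 'a \<Rightarrow> int.
        (\<Sum>a\<in>A. \<bar>c a\<bar>) \<le> int t \<longrightarrow>
        (\<Otimes>\<^bsub>G\<^esub>a\<in>A. a [^]\<^bsub>G\<^esub> c a) = \<one>\<^bsub>G\<^esub> \<longrightarrow>
        (\<forall>a\<in>A. c a = 0))"

text \<open>Meaningful for finite \<open>G\<close> only: otherwise the maximum may not exist.\<close>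

definition max_indep :: "('a, 'b) monoid_scheme \<Rightarrow> nat \<Rightarrow> nat" where
  "max_indep G t =
     (if \<exists>A. t_independent G t A then Max {card A | A. t_independent G t A} else 0)"

definition elementary_abelian :: "nat \<Rightarrow> ('a, 'b) monoid_scheme \<Rightarrow> bool" where
  "elementary_abelian p H \<longleftrightarrow>
     Factorial_Ring.prime p \<and> comm_group H \<and>
     (\<forall>x\<in>carrier H. x \<noteq> \<one>\<^bsub>H\<^esub> \<longrightarrow> group.ord H x = p)"

text \<open>
  The group \<open>H\<close> below lives on the same element type as \<open>G\<close>. This is no
  restriction: a group on another type that is isomorphic to \<open>G\<close> can be transported to
  the carrier of \<open>G\<close>.
\<close>

definition iso_elementary_abelian :: "nat \<Rightarrow> ('a, 'b) monoid_scheme \<Rightarrow> bool" where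
  "iso_elementary_abelian p G \<longleftrightarrow> (\<exists>H :: 'a monoid. elementary_abelian p H \<and> G \<cong> H)"

end

theory Submission
  imports Defs "HOL-Number_Theory.Cong"
begin

text \<open>
  A set \<open>A\<close> is \<open>3\<close>-independent iff \<open>S = A \<union> -A\<close> is a disjoint union and is
  sum-free. Hence \<open>S\<close> is disjoint from any translate \<open>a + S\<close> with \<open>a \<in> A\<close>, which gives
  \<open>4 |A| \<le> n\<close>. For the lower bound, a group that is not elementary abelian of exponent \<open>2\<close>
  or \<open>3\<close> has an element of order at least \<open>4\<close>; a faithful character of the subgroup it
  generates extends to \<open>G\<close>, and its image is cyclic of some order \<open>M \<ge> 4\<close>. The preimage of a
  \<open>3\<close>-independent set of residues modulo \<open>M\<close> is \<open>3\<close>-independent and has the same density, so it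
  is enough to treat the integers modulo \<open>M\<close>: take the odd numbers below \<open>M / 2\<close> if \<open>M\<close> is even
  and the numbers strictly between \<open>M / 3\<close> and \<open>M / 2\<close> if \<open>M\<close> is odd. The density
  \<open>1 / 9\<close> is attained by the latter choice for \<open>M = 9\<close>.
\<close>

section \<open>Subgroups of the integers\<close>

text \<open>Division with remainder by the least positive element of \<open>S\<close>: the remainder
  stays in \<open>S\<close> and so vanishes by minimality. It is applied to the exponents that bring
  a group element into a subgroup and to the integers representing the image of a character.\<close>

lemma int_subgroup_principal:
  fixes S :: "int set"
  assumes "0 \<in> S" and diff: "\<And>i j. i \<in> S \<Longrightarrow> j \<in> S \<Longrightarrow> i - j \<in> S"
  obtains d where "d \<ge> 0" "\<And>i. i \<in> S \<longleftrightarrow> d dvd i"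
proof (cases "S \<subseteq> {0}")
  case True
  then have "i \<in> S \<longleftrightarrow> 0 dvd i" for i using assms(1) by auto
  then show ?thesis using that by blast
next
  case False
  have neg: "- i \<in> S" if "i \<in> S" for i using diff[OF assms(1) that] by simp
  have add: "i + j \<in> S" if "i \<in> S" "j \<in> S" for i j using diff[OF that(1) neg[OF that(2)]] by simp
  obtain s where "s \<in> S" "s \<noteq> 0" using False by auto
  then have "\<exists>k::nat. 0 < k \<and> int k \<in> S"
    using neg[of s] by (intro exI[of _ "nat \<bar>s\<bar>"]) (auto simp: abs_if)
  then obtain k where k: "0 < k" "int k \<in> S" and least: "\<And>j. 0 < j \<Longrightarrow> int j \<in> S \<Longrightarrow> k \<le> j"
    using exists_least_iff[of "\<lambda>k. 0 < k \<and> int k \<in> S"] by (metis not_le_imp_less)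
  have mult_nat: "int m * int k \<in> S" for m
    by (induction m) (use assms(1) k add in \<open>auto simp: algebra_simps\<close>)
  have mult: "q * int k \<in> S" for q
    using mult_nat[of "nat \<bar>q\<bar>"] neg[OF mult_nat[of "nat \<bar>q\<bar>"]] by (cases "q \<ge> 0") auto
  have "int k dvd i" if "i \<in> S" for i
  proof (rule ccontr)
    assume "\<not> int k dvd i"
    then have "0 < i mod int k" using k pos_mod_sign[of "int k" i]
      by (metis dvd_eq_mod_eq_0 of_nat_0_less_iff order_less_le)
    moreover have "i mod int k \<in> S"
      using diff[OF that mult[of "i div int k"]] by (simp add: minus_div_mult_eq_mod)
    moreover have "i mod int k < int k" using k by simp
    ultimately show False using least[of "nat (i mod int k)"] by auto
  qed
  moreover have "i \<in> S" if "int k dvd i" for i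
    using that mult by (metis dvdE mult.commute)
  ultimately show ?thesis using that[of "int k"] by auto
qed

context comm_group
begin

subsection \<open>Independence in terms of sums of two and three elements\<close>

text \<open>Names the product occurring in \<open>t_independent\<close>, so that its additivity in
  the coefficient function can be used for rewriting.\<close>

definition combination :: "'a set \<Rightarrow> ('a \<Rightarrow> int) \<Rightarrow> 'a" where
  "combination A c = (\<Otimes>a\<in>A. a [^] c a)"

lemma combination_add:
  assumes "A \<subseteq> carrier G"
  shows "combination A (\<lambda>a. c a + d a) = combination A c \<otimes> combination A d"
proof -
  have "combination A (\<lambda>a. c a + d a) = (\<Otimes>a\<in>A. a [^] c a \<otimes> a [^] d a)"
    unfolding combination_def by (rule finprod_cong') (use assms in \<open>auto simp: int_pow_mult\<close>)
  then show ?thesis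
    unfolding combination_def using assms by (subst (asm) finprod_multf) auto
qed

lemma combination_closed: "A \<subseteq> carrier G \<Longrightarrow> combination A c \<in> carrier G"
  unfolding combination_def by (rule finprod_closed) auto

lemma combination_zero: "A \<subseteq> carrier G \<Longrightarrow> \<forall>a\<in>A. c a = 0 \<Longrightarrow> combination A c = \<one>"
  unfolding combination_def by (rule finprod_one_eqI) auto

lemma combination_uminus:
  assumes "A \<subseteq> carrier G"
  shows "combination A (\<lambda>a. - c a) = inv (combination A c)"
  using combination_add[OF assms, of "\<lambda>a. - c a" c] assms
  by (intro inv_equality[symmetric]) (auto simp: combination_closed combination_zero)

lemma combination_unit:
  assumes "A \<subseteq> carrier G" "finite A" "x \<in> A"
  shows "combination A (\<lambda>a. of_bool (a = x)) = x"
proof -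
  have "combination A (\<lambda>a. of_bool (a = x)) = (\<Otimes>a\<in>A. if x = a then a else \<one>)"
    unfolding combination_def by (rule finprod_cong') (use assms in \<open>auto simp: int_pow_1\<close>)
  also have "\<dots> = x" using assms by (subst finprod_singleton) auto
  finally show ?thesis .
qed

text \<open>Peels off one letter with positive coefficient at a time. That all letters have positive
  coefficient is recorded because the words obtained from the positive and the negative part of a
  coefficient function must have no letter in common.\<close>

lemma combination_nonneg_list:
  assumes A: "A \<subseteq> carrier G" "finite A"
    and "\<forall>a\<in>A. c a \<ge> 0" "(\<Sum>a\<in>A. c a) = int k"
  shows "\<exists>xs. length xs = k \<and> set xs \<subseteq> {a \<in> A. c a > 0} \<and> combination A c = foldr (\<otimes>) xs \<one>"
  using assms(3,4)
proof (induction k arbitrary: c)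
  case 0
  then have "\<forall>a\<in>A. c a = 0" using A(2) by (simp add: sum_nonneg_eq_0_iff)
  then show ?case using combination_zero[OF A(1)] by simp
next
  case (Suc k)
  have "\<exists>x\<in>A. c x > 0"
  proof (rule ccontr)
    assume "\<not> (\<exists>x\<in>A. c x > 0)"
    then have "(\<Sum>a\<in>A. c a) \<le> 0" by (intro sum_nonpos) force
    then show False using Suc.prems by simp
  qed
  then obtain x where x: "x \<in> A" "c x > 0" by blast
  define d where "d a = c a - of_bool (a = x)" for a
  have "(\<Sum>a\<in>A. d a) = (\<Sum>a\<in>A. c a) - 1"
    unfolding d_def sum_subtractf using A x by (simp add: of_bool_def)
  then have "(\<Sum>a\<in>A. d a) = int k" using Suc.prems by simp
  moreover have "\<forall>a\<in>A. d a \<ge> 0" using Suc.prems x by (auto simp: d_def)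
  ultimately obtain xs where xs: "length xs = k" "set xs \<subseteq> {a \<in> A. d a > 0}"
      "combination A d = foldr (\<otimes>) xs \<one>"
    using Suc.IH[of d] by blast
  have positive: "\<And>a. d a > 0 \<Longrightarrow> c a > 0" by (simp add: d_def of_bool_def split: if_splits)
  have "combination A c = combination A (\<lambda>a. of_bool (a = x) + d a)"
    by (simp add: d_def)
  also have "\<dots> = x \<otimes> combination A d"
    using combination_add[OF A(1)] combination_unit[OF A x(1)] by simp
  finally show ?case
    using xs x by (intro exI[of _ "x # xs"]) (use positive in auto)
qed

text \<open>Moving negative coefficients to the other side, a nontrivial relation of weight at most
  3 equates two words of lengths (1,0), (2,0), (3,0), (1,1) or (2,1), up to swapping sides. Length
  (1,0) would put the identity into \<open>A\<close>, which
  \<open>a \<otimes> b \<noteq> \<one>\<close> with \<open>a = b\<close> forbids.\<close>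

lemma t_independent_3_iff:
  "t_independent G 3 A \<longleftrightarrow> A \<subseteq> carrier G \<and> finite A \<and> A \<noteq> {} \<and>
     (\<forall>a\<in>A. \<forall>b\<in>A. a \<otimes> b \<noteq> \<one> \<and> (\<forall>c\<in>A. a \<otimes> b \<otimes> c \<noteq> \<one> \<and> a \<otimes> b \<noteq> c))"
  (is "_ \<longleftrightarrow> ?P A")
proof
  assume "t_independent G 3 A"
  then have A: "A \<subseteq> carrier G" "finite A" "A \<noteq> {}"
    and zero: "\<forall>c. (\<Sum>a\<in>A. \<bar>c a\<bar>) \<le> 3 \<longrightarrow> combination A c = \<one> \<longrightarrow> (\<forall>a\<in>A. c a = 0)"
    unfolding t_independent_def combination_def of_nat_numeral by blast+
  \<comment> \<open>Only the total of the coefficients is kept. The relations tested below have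
    totals 2, 3 and 1, so a contradiction arises without asking which of the letters
    coincide.\<close>
  have ind: "(\<Sum>a\<in>A. c a) = 0" if "(\<Sum>a\<in>A. \<bar>c a\<bar>) \<le> 3" "combination A c = \<one>" for c
    using zero that by (intro sum.neutral) blast
  let ?u = "\<lambda>x a. of_bool (a = x) :: int"
  have sum_u: "(\<Sum>a\<in>A. ?u x a) = 1" if "x \<in> A" for x
    using A that by (simp add: of_bool_def)
  note comb = combination_add[OF A(1)] combination_uminus[OF A(1)] combination_unit[OF A(1,2)]
  \<comment> \<open>Bounding by three unit functions also avoids a case split on equal letters; for
    a product of two letters, one of them is repeated as padding.\<close>
  have bound: "(\<Sum>a\<in>A. \<bar>c a\<bar>) \<le> 3"
    if "\<And>a. \<bar>c a\<bar> \<le> ?u x a + ?u y a + ?u z a" "x \<in> A" "y \<in> A" "z \<in> A" for c x y z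
  proof -
    have "(\<Sum>a\<in>A. \<bar>c a\<bar>) \<le> (\<Sum>a\<in>A. ?u x a + ?u y a + ?u z a)" by (rule sum_mono) (rule that)
    also have "\<dots> = 3" by (simp only: sum.distrib sum_u that)
    finally show ?thesis .
  qed
  have "a \<otimes> b \<noteq> \<one>" if "a \<in> A" "b \<in> A" for a b
  proof
    assume "a \<otimes> b = \<one>"
    then have "combination A (\<lambda>s. ?u a s + ?u b s) = \<one>" using that by (simp only: comb)
    then have "(\<Sum>s\<in>A. ?u a s + ?u b s) = 0"
      by (intro ind bound[of _ a b b]) (use that in auto)
    then show False unfolding sum.distrib sum_u[OF that(1)] sum_u[OF that(2)] by simp
  qed
  moreover have "a \<otimes> b \<otimes> c \<noteq> \<one>" if "a \<in> A" "b \<in> A" "c \<in> A" for a b c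
  proof
    assume "a \<otimes> b \<otimes> c = \<one>"
    then have "combination A (\<lambda>s. ?u a s + ?u b s + ?u c s) = \<one>" using that by (simp only: comb)
    then have "(\<Sum>s\<in>A. ?u a s + ?u b s + ?u c s) = 0"
      by (intro ind bound[of _ a b c]) (use that in auto)
    then show False
      unfolding sum.distrib sum_u[OF that(1)] sum_u[OF that(2)] sum_u[OF that(3)] by simp
  qed
  moreover have "a \<otimes> b \<noteq> c" if "a \<in> A" "b \<in> A" "c \<in> A" for a b c
  proof
    assume "a \<otimes> b = c"
    then have "a \<otimes> b \<otimes> inv c = \<one>" using that A by auto
    then have "combination A (\<lambda>s. ?u a s + ?u b s + - ?u c s) = \<one>" using that by (simp only: comb)
    then have "(\<Sum>s\<in>A. ?u a s + ?u b s + - ?u c s) = 0"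
      by (intro ind bound[of _ a b c]) (use that in auto)
    then show False
      unfolding sum.distrib sum_negf sum_u[OF that(1)] sum_u[OF that(2)] sum_u[OF that(3)] by simp
  qed
  ultimately show "?P A" using A by blast
next
  assume P: "?P A"
  then have A: "A \<subseteq> carrier G" "finite A" by auto
  have no1: "a \<noteq> \<one>" if "a \<in> A" for a using P A that by (metis l_one subsetD)
  \<comment> \<open>A nonnegative total, which negating \<open>c\<close> can always achieve, makes
    the word of the positive part at least as long as that of the negative part.\<close>
  have key: False
    if "(\<Sum>a\<in>A. \<bar>c a\<bar>) \<le> 3" "combination A c = \<one>" "\<exists>a\<in>A. c a \<noteq> 0"
      "(\<Sum>a\<in>A. c a) \<ge> 0" for c
  proof -
    define p q where "p a = max (c a) 0" and "q a = max (- c a) 0" for a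
    have nonneg: "\<forall>a\<in>A. p a \<ge> 0" "\<forall>a\<in>A. q a \<ge> 0" by (simp_all add: p_def q_def)
    then have sums: "(\<Sum>a\<in>A. p a) = int (nat (\<Sum>a\<in>A. p a))"
        "(\<Sum>a\<in>A. q a) = int (nat (\<Sum>a\<in>A. q a))"
      by (simp_all add: sum_nonneg)
    obtain xs where xs: "int (length xs) = (\<Sum>a\<in>A. p a)" "set xs \<subseteq> {a \<in> A. p a > 0}"
        "combination A p = foldr (\<otimes>) xs \<one>"
      using combination_nonneg_list[OF A nonneg(1) sums(1)] sums(1) by metis
    obtain ys where ys: "int (length ys) = (\<Sum>a\<in>A. q a)" "set ys \<subseteq> {a \<in> A. q a > 0}"
        "combination A q = foldr (\<otimes>) ys \<one>"
      using combination_nonneg_list[OF A nonneg(2) sums(2)] sums(2) by metis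
    have sub: "set xs \<subseteq> A" "set ys \<subseteq> A" using xs ys by auto
    \<comment> \<open>This excludes the case of one letter on each side, where the relation would
      read \<open>x = z\<close>.\<close>
    have disj: "set xs \<inter> set ys = {}" using xs(2) ys(2) by (fastforce simp: p_def q_def subset_iff)
    have "p = (\<lambda>a. c a + q a)" by (auto simp: p_def q_def)
    then have eq: "foldr (\<otimes>) xs \<one> = foldr (\<otimes>) ys \<one>"
      using combination_add[OF A(1), of c q] xs(3) ys(3) that(2) combination_closed[OF A(1), of q]
      by (metis l_one)
    have "(\<Sum>a\<in>A. p a) - (\<Sum>a\<in>A. q a) = (\<Sum>a\<in>A. c a)"
      unfolding sum_subtractf[symmetric] by (rule sum.cong) (auto simp: p_def q_def)
    then have le: "length ys \<le> length xs" using that(4) xs(1) ys(1) by linarith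
    have sum_abs: "(\<Sum>a\<in>A. p a) + (\<Sum>a\<in>A. q a) = (\<Sum>a\<in>A. \<bar>c a\<bar>)"
      unfolding sum.distrib[symmetric] by (rule sum.cong) (auto simp: p_def q_def)
    moreover have "(\<Sum>a\<in>A. \<bar>c a\<bar>) > 0"
      using that(3) A(2) by (auto intro: sum_pos2)
    ultimately have len: "0 < length xs + length ys" "length xs + length ys \<le> 3"
      using that(1) xs(1) ys(1) by linarith+
    have "length ys = 0 \<and> (length xs = 1 \<or> length xs = 2 \<or> length xs = 3) \<or>
        length ys = 1 \<and> (length xs = 1 \<or> length xs = 2)"
      using le len by linarith
    then consider x where "ys = []" "xs = [x]" | x y where "ys = []" "xs = [x,y]"
      | x y z where "ys = []" "xs = [x,y,z]" | x z where "ys = [z]" "xs = [x]"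
      | x y z where "ys = [z]" "xs = [x,y]"
      by (auto simp: length_Suc_conv numeral_2_eq_2 numeral_3_eq_3)
    then show False
    proof cases
      case 1 then show ?thesis using eq sub no1 A by auto
    next
      case 2 then show ?thesis using eq sub P A by auto
    next
      case 3
      then have "x \<in> A" "y \<in> A" "z \<in> A" using sub by auto
      moreover from this have "x \<otimes> y \<otimes> z = \<one>" using 3 eq A by (auto simp: m_assoc subset_iff)
      ultimately show ?thesis using P by blast
    next
      case 4 then show ?thesis using eq sub disj A by (auto simp: subset_iff)
    next
      case 5
      then have "x \<in> A" "y \<in> A" "z \<in> A" using sub by auto
      moreover from this have "x \<otimes> y = z" using 5 eq A by (auto simp: subset_iff)
      ultimately show ?thesis using P by blast
    qed
  qed
  have "\<forall>a\<in>A. c a = 0" if c: "(\<Sum>a\<in>A. \<bar>c a\<bar>) \<le> 3" "combination A c = \<one>" for c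
  proof (rule ccontr)
    assume nz: "\<not> (\<forall>a\<in>A. c a = 0)"
    show False
    proof (cases "(\<Sum>a\<in>A. c a) \<ge> 0")
      case True then show ?thesis using key[of c] c nz by blast
    next
      case False
      then show ?thesis
        using key[of "\<lambda>a. - c a"] c nz combination_uminus[OF A(1), of c] by (simp add: sum_negf)
    qed
  qed
  then show "t_independent G 3 A"
    using P unfolding t_independent_def combination_def of_nat_numeral by blast
qed

section \<open>The upper bound \<open>n / 4\<close>\<close>

lemma t_independent_3_card_le:
  assumes "finite (carrier G)" "t_independent G 3 A"
  shows "4 * card A \<le> order G"
proof -
  have A: "A \<subseteq> carrier G" "finite A" "A \<noteq> {}"
    and ab: "\<And>a b. a \<in> A \<Longrightarrow> b \<in> A \<Longrightarrow> a \<otimes> b \<noteq> \<one>"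
    and abc: "\<And>a b c. a \<in> A \<Longrightarrow> b \<in> A \<Longrightarrow> c \<in> A \<Longrightarrow> a \<otimes> b \<otimes> c \<noteq> \<one>"
    and sumfree: "\<And>a b c. a \<in> A \<Longrightarrow> b \<in> A \<Longrightarrow> c \<in> A \<Longrightarrow> a \<otimes> b \<noteq> c"
    using assms(2) unfolding t_independent_3_iff by auto
  have mem [simp]: "x \<in> carrier G" if "x \<in> A" for x using A that by auto
  define S where "S = A \<union> m_inv G ` A"
  have "A \<inter> m_inv G ` A = {}" using ab by force
  moreover have "card (m_inv G ` A) = card A"
    by (rule card_image) (use A inv_inj in \<open>auto intro: inj_on_subset\<close>)
  ultimately have cardS: "card S = 2 * card A"
    using A(2) unfolding S_def by (subst card_Un_disjoint) auto
  have S: "S \<subseteq> carrier G" using A by (auto simp: S_def)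
  obtain a where a: "a \<in> A" using A by auto
  have "inj_on (\<lambda>x. a \<otimes> x) S" using inj_on_cmult[of a] S a by (auto intro: inj_on_subset)
  then have card_aS: "card ((\<lambda>x. a \<otimes> x) ` S) = 2 * card A" by (simp add: card_image cardS)
  have "a \<otimes> x \<noteq> y" if "x \<in> S" "y \<in> S" for x y
  proof
    assume eq: "a \<otimes> x = y"
    \<comment> \<open>Depending on which of \<open>x\<close> and \<open>y\<close> are inverses, the
      equation rearranges to \<open>a \<otimes> x = y\<close>,
      \<open>a \<otimes> x \<otimes> c = \<one>\<close>, \<open>y \<otimes> b = a\<close> or
      \<open>a \<otimes> c = b\<close>, all forbidden among elements of \<open>A\<close>.\<close>
    consider "x \<in> A" "y \<in> A" | c where "x \<in> A" "c \<in> A" "y = inv c"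
      | b where "b \<in> A" "x = inv b" "y \<in> A"
      | b c where "b \<in> A" "x = inv b" "c \<in> A" "y = inv c"
      using \<open>x \<in> S\<close> \<open>y \<in> S\<close> unfolding S_def by blast
    then show False
    proof cases
      case 1 then show ?thesis using sumfree a eq by blast
    next
      case 2
      then have "a \<otimes> x \<otimes> c = \<one>" using eq by simp
      then show ?thesis using abc a 2 by blast
    next
      case 3
      then have "y \<otimes> b = a" using eq a by (metis inv_closed inv_solve_right mem)
      then show ?thesis using sumfree a 3 by blast
    next
      case 4
      then have "a \<otimes> c = b"
        using eq a by (metis inv_closed inv_solve_right inv_solve_left m_comm mem)
      then show ?thesis using sumfree a 4 by blast
    qed
  qed
  then have "S \<inter> (\<lambda>x. a \<otimes> x) ` S = {}" by blast
  moreover have "finite S" using S assms(1) finite_subset by blast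
  ultimately have "card (S \<union> (\<lambda>x. a \<otimes> x) ` S) = 4 * card A"
    by (subst card_Un_disjoint) (auto simp: cardS card_aS)
  moreover have "S \<union> (\<lambda>x. a \<otimes> x) ` S \<subseteq> carrier G" using S a by auto
  ultimately show ?thesis unfolding order_def using assms(1) card_mono by metis
qed

subsection \<open>Characters with values in the integers modulo \<open>N\<close>\<close>

text \<open>A homomorphism from \<open>H\<close> to the integers modulo \<open>N\<close>,
  represented by arbitrary integer lifts of its values; hence congruences take the place of
  equations throughout.\<close>

definition additive_mod :: "int \<Rightarrow> 'a set \<Rightarrow> ('a \<Rightarrow> int) \<Rightarrow> bool" where
  "additive_mod N H f \<longleftrightarrow> (\<forall>x\<in>H. \<forall>y\<in>H. [f (x \<otimes> y) = f x + f y] (mod N))"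

lemma additive_modD:
  "additive_mod N H f \<Longrightarrow> x \<in> H \<Longrightarrow> y \<in> H \<Longrightarrow> [f (x \<otimes> y) = f x + f y] (mod N)"
  by (simp add: additive_mod_def)

lemma additive_mod_one:
  assumes "additive_mod N H f" "subgroup H G"
  shows "[f \<one> = 0] (mod N)"
proof -
  have "[f \<one> + 0 = f \<one> + f \<one>] (mod N)"
    using additive_modD[OF assms(1), of \<one> \<one>] subgroup.one_closed[OF assms(2)] by simp
  then show ?thesis by (metis cong_add_lcancel cong_sym)
qed

lemma additive_mod_inv:
  assumes "additive_mod N H f" "subgroup H G" "x \<in> H"
  shows "[f (inv x) = - f x] (mod N)"
proof -
  have x: "x \<in> carrier G" "inv x \<in> H"
    using subgroup.mem_carrier[OF assms(2,3)] subgroup.m_inv_closed[OF assms(2,3)] .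
  have "[f \<one> = f x + f (inv x)] (mod N)"
    using additive_modD[OF assms(1) assms(3) x(2)] x by simp
  then have "[f x + f (inv x) = f x + - f x] (mod N)"
    using additive_mod_one[OF assms(1,2)] by (metis cong_sym cong_trans add.right_inverse)
  then show ?thesis by (simp only: cong_add_lcancel)
qed

lemma additive_mod_int_pow:
  assumes "additive_mod N H f" "subgroup H G" "x \<in> H"
  shows "[f (x [^] (i::int)) = i * f x] (mod N)"
proof -
  have x: "x \<in> carrier G" using subgroup.mem_carrier[OF assms(2,3)] .
  have powH: "x [^] k \<in> H" for k :: nat
    by (induction k) (use assms in \<open>auto simp: subgroup.one_closed subgroup.m_closed\<close>)
  have nat: "[f (x [^] k) = int k * f x] (mod N)" for k :: nat
  proof (induction k)
    case 0 show ?case using additive_mod_one[OF assms(1,2)] by simp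
  next
    case (Suc k)
    from additive_modD[OF assms(1) powH assms(3)]
    have "[f (x [^] Suc k) = f (x [^] k) + f x] (mod N)" by simp
    also have "[f (x [^] k) + f x = int k * f x + f x] (mod N)" using Suc by (simp add: cong_add)
    finally show ?case by (simp add: algebra_simps)
  qed
  show ?thesis
  proof (cases i rule: int_cases2)
    case (nonneg k)
    then show ?thesis using nat[of k] by (simp add: int_pow_int)
  next
    case (nonpos k)
    have "[f (inv (x [^] k)) = - f (x [^] k)] (mod N)"
      by (rule additive_mod_inv[OF assms(1,2) powH])
    also have "[- f (x [^] k) = - (int k * f x)] (mod N)"
      using nat[of k] by (simp only: cong_minus_minus_iff)
    finally show ?thesis using nonpos x by (simp add: int_pow_neg_int)
  qed
qed

text \<open>On the subgroup generated by \<open>H\<close> and \<open>x\<close>, the extension has to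
  send \<open>h \<otimes> x [^] i\<close> to \<open>f h + i * y\<close>. The two parts overlap only
  in powers of \<open>x [^] k\<close>, so the congruence for \<open>k * y\<close> is exactly the
  consistency condition.\<close>

lemma additive_mod_extend_step:
  assumes H: "subgroup H G" and f: "additive_mod N H f" and x: "x \<in> carrier G"
    and k: "\<And>i::int. x [^] i \<in> H \<longleftrightarrow> k dvd i" and y: "[k * y = f (x [^] k)] (mod N)"
  shows "\<exists>H' f'. subgroup H' G \<and> additive_mod N H' f' \<and> H \<subseteq> H' \<and> x \<in> H' \<and>
    (\<forall>h\<in>H. [f' h = f h] (mod N)) \<and> [f' x = y] (mod N)"
proof -
  note Hc = subgroup.mem_carrier[OF H] and HI = subgroup.one_closed[OF H]
    subgroup.m_closed[OF H] subgroup.m_inv_closed[OF H]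
  \<comment> \<open>Two representations of an element differ by \<open>x [^] (i - j)\<close>, which
    lies in \<open>H\<close>. So \<open>i - j\<close> is a multiple \<open>k * q\<close>, and
    \<open>f\<close> takes the value \<open>q * (k * y)\<close> there modulo
    \<open>N\<close>.\<close>
  have well_defined: "[f h + i * y = f h' + j * y] (mod N)"
    if "h \<in> H" "h' \<in> H" and eq: "h \<otimes> x [^] i = h' \<otimes> x [^] j" for h h' and i j :: int
  proof -
    have c: "h \<in> carrier G" "h' \<in> carrier G" using that Hc by auto
    have "h \<otimes> (x [^] (i - j)) \<otimes> x [^] j = h' \<otimes> x [^] j"
      using c x eq by (simp add: m_assoc int_pow_mult[symmetric])
    then have h': "h' = h \<otimes> x [^] (i - j)" using c x by simp
    then have "x [^] (i - j) = inv h \<otimes> h'" using c x by (simp add: m_assoc[symmetric])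
    then have "x [^] (i - j) \<in> H" using that HI by auto
    then obtain q where q: "i - j = k * q" using k by blast
    have xk: "x [^] k \<in> H" using k by simp
    have "[f h' = f h + f (x [^] (i - j))] (mod N)"
      using additive_modD[OF f \<open>h \<in> H\<close> \<open>x [^] (i - j) \<in> H\<close>] h' by simp
    moreover have "[f (x [^] (i - j)) = q * f (x [^] k)] (mod N)"
      using additive_mod_int_pow[OF f H xk, of q] x q by (simp add: int_pow_pow)
    moreover have "[q * f (x [^] k) = q * (k * y)] (mod N)"
      using y by (intro cong_mult) (auto intro: cong_sym)
    moreover have "q * (k * y) = (i - j) * y" using q by simp
    ultimately have "[f h' = f h + (i - j) * y] (mod N)"
      by (metis cong_add_lcancel cong_trans)
    then have "[f h' + j * y = f h + (i - j) * y + j * y] (mod N)"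
      by (simp only: cong_add_rcancel)
    then show ?thesis by (simp add: algebra_simps cong_sym)
  qed
  define H' where "H' = {h \<otimes> x [^] i | h (i::int). h \<in> H}"
  \<comment> \<open>The choice of a representation is arbitrary; by \<open>well_defined\<close> it
    affects the value only by a multiple of \<open>N\<close>.\<close>
  define f' where "f' z = (SOME v. \<exists>h\<in>H. \<exists>i::int. z = h \<otimes> x [^] i \<and> v = f h + i * y)" for z
  have f': "[f' (h \<otimes> x [^] i) = f h + i * y] (mod N)" if "h \<in> H" for h and i :: int
  proof -
    have "\<exists>h'\<in>H. \<exists>j::int. h \<otimes> x [^] i = h' \<otimes> x [^] j \<and> f' (h \<otimes> x [^] i) = f h' + j * y"
      unfolding f'_def by (rule someI_ex) (use that in blast)
    then show ?thesis using well_defined that by (metis cong_sym)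
  qed
  have mult: "(h \<otimes> x [^] i) \<otimes> (h' \<otimes> x [^] j) = (h \<otimes> h') \<otimes> x [^] (i + j)"
    if "h \<in> H" "h' \<in> H" for h h' and i j :: int
    using that Hc x by (simp add: int_pow_mult m_ac)
  have "subgroup H' G"
  proof (rule subgroupI)
    show "H' \<subseteq> carrier G" using Hc x by (auto simp: H'_def)
    show "H' \<noteq> {}" using HI by (auto simp: H'_def)
  next
    fix z assume "z \<in> H'"
    then obtain h i where z: "z = h \<otimes> x [^] (i::int)" "h \<in> H" by (auto simp: H'_def)
    then have "inv z = inv h \<otimes> x [^] (- i)"
      using Hc x by (simp add: inv_mult int_pow_neg)
    then show "inv z \<in> H'" using z HI by (auto simp: H'_def)
  next
    fix z w assume "z \<in> H'" "w \<in> H'"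
    then obtain h i h' j where "z = h \<otimes> x [^] (i::int)" "h \<in> H" "w = h' \<otimes> x [^] (j::int)" "h' \<in> H"
      by (auto simp: H'_def)
    then have "z \<otimes> w = (h \<otimes> h') \<otimes> x [^] (i + j)" "h \<otimes> h' \<in> H" using mult HI by auto
    then show "z \<otimes> w \<in> H'" unfolding H'_def by blast
  qed
  moreover have "additive_mod N H' f'"
    unfolding additive_mod_def
  proof (intro ballI)
    fix z w assume "z \<in> H'" "w \<in> H'"
    then obtain h i h' j where z: "z = h \<otimes> x [^] (i::int)" "h \<in> H"
      and w: "w = h' \<otimes> x [^] (j::int)" "h' \<in> H" by (auto simp: H'_def)
    have "[f' (z \<otimes> w) = f (h \<otimes> h') + (i + j) * y] (mod N)"
      using f'[of "h \<otimes> h'" "i + j"] z w mult HI by simp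
    also have "[f (h \<otimes> h') + (i + j) * y = f h + f h' + (i + j) * y] (mod N)"
      using additive_modD[OF f z(2) w(2)] by (simp only: cong_add_rcancel)
    also have "f h + f h' + (i + j) * y = (f h + i * y) + (f h' + j * y)"
      by (simp add: algebra_simps)
    also have "[\<dots> = f' z + f' w] (mod N)"
      unfolding z w using f' z w by (intro cong_add) (auto intro: cong_sym)
    finally show "[f' (z \<otimes> w) = f' z + f' w] (mod N)" .
  qed
  moreover have hom0: "h = h \<otimes> x [^] (0::int)" if "h \<in> H" for h using Hc[OF that] by simp
  then have "H \<subseteq> H'" unfolding H'_def by blast
  moreover have "[f' h = f h] (mod N)" if "h \<in> H" for h
    using f'[OF that, of 0] hom0[OF that] by simp
  moreover have x1: "x = \<one> \<otimes> x [^] (1::int)" using x by (simp add: int_pow_1)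
  then have "x \<in> H'" unfolding H'_def using HI by blast
  moreover have "[f' x = y] (mod N)"
  proof -
    have "[f' x = f \<one> + y] (mod N)" using f'[OF HI(1), of 1] x1 by simp
    also have "[f \<one> + y = 0 + y] (mod N)"
      using additive_mod_one[OF f H] by (simp only: cong_add_rcancel)
    finally show ?thesis by simp
  qed
  ultimately show ?thesis by blast
qed

text \<open>One element is adjoined at a time, by induction on the number of elements outside
  \<open>H\<close>. Taking the group order as modulus guarantees that a value for the new element
  exists.\<close>

lemma additive_mod_extend:
  assumes fin: "finite (carrier G)"
    and "subgroup H G" "additive_mod (int (order G)) H f"
  shows "\<exists>F. additive_mod (int (order G)) (carrier G) F \<and>
             (\<forall>h\<in>H. [F h = f h] (mod int (order G)))"
  using assms(2,3)
proof (induction "card (carrier G - H)" arbitrary: H f rule: less_induct)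
  case less
  note H = less.prems(1) and f = less.prems(2)
  let ?N = "int (order G)"
  have Npos: "?N > 0" using fin order_gt_0_iff_finite by simp
  show ?case
  proof (cases "H = carrier G")
    case True
    then show ?thesis using f by (intro exI[of _ f]) auto
  next
    case False
    then obtain x where x: "x \<in> carrier G" "x \<notin> H" using subgroup.subset[OF H] by blast
    \<comment> \<open>\<open>k\<close> is the order of \<open>x\<close> modulo
      \<open>H\<close>.\<close>
    obtain k where k0: "k \<ge> 0" and k: "\<And>i::int. i \<in> {i. x [^] i \<in> H} \<longleftrightarrow> k dvd i"
    proof (rule int_subgroup_principal[of "{i. x [^] i \<in> H}"])
      show "0 \<in> {i::int. x [^] i \<in> H}" using subgroup.one_closed[OF H] by simp
      show "i - j \<in> {i::int. x [^] i \<in> H}"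
        if "i \<in> {i. x [^] i \<in> H}" "j \<in> {i. x [^] i \<in> H}" for i j
        using that x subgroup.m_closed[OF H] subgroup.m_inv_closed[OF H]
        by (simp add: int_pow_diff)
    qed blast
    have xN: "x [^] ?N = \<one>" using x pow_order_eq_1 by (simp add: int_pow_int)
    then have "k dvd ?N" using k[of ?N] subgroup.one_closed[OF H] by simp
    then obtain r where r: "?N = k * r" by blast
    have xk: "x [^] k \<in> H" using k[of k] by simp
    \<comment> \<open>The group order is \<open>k * r\<close>, so raising \<open>x [^] k\<close> to
      the power \<open>r\<close> gives the identity. Thus \<open>k * r\<close> divides
      \<open>r * f (x [^] k)\<close>, hence \<open>k\<close> divides \<open>f (x [^] k)\<close>, and
      the quotient serves as \<open>y\<close>.\<close>
    have "[f ((x [^] k) [^] r) = r * f (x [^] k)] (mod ?N)"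
      by (rule additive_mod_int_pow[OF f H xk])
    moreover have "(x [^] k) [^] r = \<one>" using x xN r by (simp add: int_pow_pow)
    ultimately have "[r * f (x [^] k) = 0] (mod ?N)"
      using additive_mod_one[OF f H] by (metis cong_sym cong_trans)
    then have "r * k dvd r * f (x [^] k)" using r by (simp add: cong_0_iff mult.commute)
    moreover have "r \<noteq> 0" using r Npos by auto
    ultimately have "k dvd f (x [^] k)" by simp
    then obtain y where y: "f (x [^] k) = k * y" by blast
    have yk: "[k * y = f (x [^] k)] (mod ?N)" using y by simp
    have k': "x [^] i \<in> H \<longleftrightarrow> k dvd i" for i :: int using k[of i] by simp
    obtain H' f' where H': "subgroup H' G" "additive_mod ?N H' f'" "H \<subseteq> H'" "x \<in> H'"
      and f': "\<forall>h\<in>H. [f' h = f h] (mod ?N)"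
      using additive_mod_extend_step[OF H f x(1) k' yk] by blast
    have "carrier G - H' \<subset> carrier G - H" using H' x by blast
    then have "card (carrier G - H') < card (carrier G - H)"
      using fin by (intro psubset_card_mono) auto
    from less.hyps[OF this H'(1,2)] obtain F where
      "additive_mod ?N (carrier G) F" "\<forall>h\<in>H'. [F h = f' h] (mod ?N)" by blast
    then show ?thesis using f' H'(3) by (meson cong_trans subsetD)
  qed
qed

text \<open>The element \<open>z\<close> encodes surjectivity onto the residues modulo
  \<open>M\<close>: its powers take every value.\<close>

lemma surjective_character:
  assumes fin: "finite (carrier G)" and g: "g \<in> carrier G"
  obtains M f z where "M \<ge> int (ord g)" "additive_mod M (carrier G) f"
    "z \<in> carrier G" "[f z = 1] (mod M)"
proof -
  define N where "N = int (order G)"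
  have Npos: "N > 0" using fin order_gt_0_iff_finite by (simp add: N_def)
  define m where "m = int (ord g)"
  have mpos: "m > 0" using ord_ge_1[OF fin g] by (simp add: m_def)
  have "m dvd N" using ord_dvd_group_order[OF g] by (simp add: m_def N_def)
  then obtain q where q: "N = m * q" by blast
  have car: "subgroup (carrier G) G" by (rule subgroup_self)
  have triv: "subgroup {\<one>} G" by (rule triv_subgroup)
  \<comment> \<open>Starting from the trivial subgroup, \<open>g\<close> is sent to
    \<open>q = N / ord g\<close>, a residue of additive order exactly \<open>ord g\<close> modulo
    \<open>N\<close>.\<close>
  have "additive_mod N {\<one>} (\<lambda>_. 0)" by (simp add: additive_mod_def)
  moreover have "g [^] i \<in> {\<one>} \<longleftrightarrow> m dvd i" for i :: int
    using int_pow_eq_id[OF g] by (simp add: m_def)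
  moreover have "[m * q = 0] (mod N)" using q by (simp add: cong_0_iff)
  ultimately obtain H' f' where
    H': "subgroup H' G" "additive_mod N H' f'" "g \<in> H'" "[f' g = q] (mod N)"
    using additive_mod_extend_step[OF triv _ g, of N "\<lambda>_. 0" m q] by blast
  obtain F where F: "additive_mod N (carrier G) F" and "[F g = f' g] (mod N)"
    using additive_mod_extend[OF fin H'(1) H'(2)[unfolded N_def]] H'(3) unfolding N_def by blast
  then have Fg: "[F g = q] (mod N)" using H'(4) cong_trans by blast
  \<comment> \<open>All integers representing a value of \<open>F\<close>. This is a subgroup
    containing \<open>N\<close>, so it consists of the multiples of a divisor \<open>d\<close> of
    \<open>N\<close>, and the image of \<open>F\<close> has \<open>M = N / d\<close>
    elements.\<close>
  define S where "S = {i. \<exists>x\<in>carrier G. [F x = i] (mod N)}"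
  have F1: "[F \<one> = 0] (mod N)" by (rule additive_mod_one[OF F car])
  obtain d where d0: "d \<ge> 0" and d: "\<And>i. i \<in> S \<longleftrightarrow> d dvd i"
  proof (rule int_subgroup_principal[of S])
    show "0 \<in> S" unfolding S_def using F1 by blast
    show "i - j \<in> S" if ij: "i \<in> S" "j \<in> S" for i j
    proof -
      obtain x y where xy: "x \<in> carrier G" "y \<in> carrier G" "[F x = i] (mod N)" "[F y = j] (mod N)"
        using ij unfolding S_def by blast
      have "[F (x \<otimes> inv y) = F x + F (inv y)] (mod N)"
        using xy by (intro additive_modD[OF F]) auto
      also have "[F x + F (inv y) = i + - j] (mod N)"
      proof (rule cong_add[OF xy(3)])
        have "[F (inv y) = - F y] (mod N)" by (rule additive_mod_inv[OF F car xy(2)])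
        also have "[- F y = - j] (mod N)" using xy(4) by (simp only: cong_minus_minus_iff)
        finally show "[F (inv y) = - j] (mod N)" .
      qed
      finally have "[F (x \<otimes> inv y) = i - j] (mod N)" by simp
      then show ?thesis unfolding S_def using xy by blast
    qed
  qed blast
  have "[F \<one> = N] (mod N)" using F1 by (simp add: cong_def)
  then have "N \<in> S" unfolding S_def by blast
  then obtain M where M: "N = d * M" using d by blast
  have dpos: "d > 0" using d0 M Npos by (cases "d = 0") auto
  have "q \<in> S" unfolding S_def using Fg g by blast
  then obtain r where r: "q = d * r" using d by blast
  \<comment> \<open>From \<open>N = m * q\<close>, \<open>q = d * r\<close> and
    \<open>N = d * M\<close>; this is where the image inherits a size of at least
    \<open>ord g\<close>.\<close>
  have "M = m * r" using M q r dpos by simp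
  moreover have "r > 0" using Npos mpos dpos r q by (simp add: zero_less_mult_iff)
  ultimately have Mm: "M \<ge> m" using mpos by simp
  have dF: "d dvd F x" if "x \<in> carrier G" for x
    using d[of "F x"] that unfolding S_def by (blast intro: cong_refl)
  \<comment> \<open>The division is exact, and it turns congruences modulo \<open>N\<close> into
    congruences modulo \<open>M\<close>, making \<open>1\<close> a value.\<close>
  define f where "f x = F x div d" for x
  have fd: "F x = d * f x" if "x \<in> carrier G" for x using dF[OF that] by (simp add: f_def)
  have cancel: "[a = b] (mod M) \<longleftrightarrow> [d * a = d * b] (mod N)" for a b
    using dpos M by (simp add: cong_iff_dvd_diff right_diff_distrib[symmetric])
  have "additive_mod M (carrier G) f"
    unfolding additive_mod_def cancel
    using additive_modD[OF F] by (simp add: fd distrib_left)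
  moreover obtain z where "z \<in> carrier G" "[F z = d] (mod N)"
    using d[of d] unfolding S_def by auto
  moreover from this have "[f z = 1] (mod M)" unfolding cancel by (simp add: fd)
  ultimately show ?thesis using that Mm m_def by blast
qed

text \<open>Multiplication by powers of \<open>z\<close> carries any fibre of \<open>f\<close>
  injectively into any other, so all fibres have the same size and preimages keep their
  density.\<close>

lemma card_character_preimage:
  assumes fin: "finite (carrier G)" and f: "additive_mod M (carrier G) f" and "M > 0"
    and z: "z \<in> carrier G" "[f z = 1] (mod M)" and T: "T \<subseteq> {0..<M}"
  shows "int (card {x \<in> carrier G. f x mod M \<in> T}) * M = int (order G) * int (card T)"
proof -
  define F where "F k = {x \<in> carrier G. [f x = k] (mod M)}" for k
  have finF: "finite (F k)" for k using fin by (simp add: F_def)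
  have car: "subgroup (carrier G) G" by (rule subgroup_self)
  have shift: "(\<lambda>x. x \<otimes> z [^] k) ` F l \<subseteq> F (l + k)" for k l :: int
  proof (clarsimp simp: F_def z)
    fix x assume x: "x \<in> carrier G" "[f x = l] (mod M)"
    have "[f (z [^] k) = k * 1] (mod M)"
      using additive_mod_int_pow[OF f car z(1), of k] z(2)
      by (metis cong_mult cong_refl cong_trans)
    then have "[f x + f (z [^] k) = l + k] (mod M)" using x(2) by (intro cong_add) auto
    then show "[f (x \<otimes> z [^] k) = l + k] (mod M)"
      using additive_modD[OF f x(1), of "z [^] k"] z by (meson cong_trans int_pow_closed)
  qed
  have inj: "inj_on (\<lambda>x. x \<otimes> z [^] k) (F l)" for k l :: int
    by (rule inj_onI) (use z in \<open>auto simp: F_def\<close>)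
  have le: "card (F l) \<le> card (F (l + k))" for k l
    using card_mono[OF finF shift] card_image[OF inj] by metis
  have fibre: "card (F k) = card (F 0)" for k
    using le[of 0 k] le[of k "- k"] by simp
  have card_pre: "card {x \<in> carrier G. f x mod M \<in> U} = card U * card (F 0)" if U: "U \<subseteq> {0..<M}" for U
  proof -
    have "finite U" using U finite_subset by blast
    have eq: "f x mod M = k \<longleftrightarrow> [f x = k] (mod M)" if "k \<in> U" for x k
      using that U by (auto simp: cong_def)
    have "f x mod M \<in> U \<longleftrightarrow> (\<exists>k\<in>U. [f x = k] (mod M))" for x using eq by metis
    then have "{x \<in> carrier G. f x mod M \<in> U} = (\<Union>k\<in>U. F k)" by (auto simp: F_def)
    moreover have "F k \<inter> F j = {}" if "k \<in> U" "j \<in> U" "k \<noteq> j" for k j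
      using that(3) by (auto simp: F_def simp flip: eq[OF that(1)] eq[OF that(2)])
    then have "card (\<Union>k\<in>U. F k) = (\<Sum>k\<in>U. card (F k))"
      by (intro card_UN_disjoint) (use \<open>finite U\<close> finF in auto)
    moreover have "(\<Sum>k\<in>U. card (F k)) = (\<Sum>k\<in>U. card (F 0))"
      by (rule sum.cong[OF refl fibre])
    ultimately show ?thesis by simp
  qed
  \<comment> \<open>The full set of residues counts the group itself, which determines the common
    fibre size.\<close>
  have "{x \<in> carrier G. f x mod M \<in> {0..<M}} = carrier G" using \<open>M > 0\<close> by auto
  then have "order G = nat M * card (F 0)" using card_pre[of "{0..<M}"] by (simp add: order_def)
  then show ?thesis using card_pre[OF T] \<open>M > 0\<close> by simp
qed

end

section \<open>Independent sets of residues\<close>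

text \<open>For even \<open>M\<close>, parity excludes the relations with three terms, and sums of
  two elements lie strictly between 0 and \<open>M\<close>. For odd \<open>M\<close>, size alone
  suffices: \<open>a + b\<close> lies between \<open>2M/3\<close> and \<open>M\<close>,
  \<open>a + b + c\<close> between \<open>M\<close> and \<open>3M/2\<close>, and
  \<open>a + b - c\<close> between \<open>M/6\<close> and \<open>2M/3\<close>, always
  strictly.\<close>

lemma residues_3_independent:
  fixes M :: int
  assumes "M \<ge> 4"
  obtains T where "T \<subseteq> {0..<M}" "9 * int (card T) \<ge> M"
    "\<And>a b. a \<in> T \<Longrightarrow> b \<in> T \<Longrightarrow> \<not> M dvd a + b"
    "\<And>a b c. a \<in> T \<Longrightarrow> b \<in> T \<Longrightarrow> c \<in> T \<Longrightarrow> \<not> M dvd a + b + c"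
    "\<And>a b c. a \<in> T \<Longrightarrow> b \<in> T \<Longrightarrow> c \<in> T \<Longrightarrow> \<not> M dvd a + b - c"
proof (cases "even M")
  case True
  then obtain j where j: "M = 2 * j" by blast
  \<comment> \<open>The largest element is \<open>2 * (j div 2) - 1\<close>, which is below
    \<open>j = M / 2\<close> for either parity of \<open>j\<close>.\<close>
  define T where "T = (\<lambda>i. 2 * i + 1) ` {0..<j div 2}"
  have T: "odd a" "0 < a" "a < j" if "a \<in> T" for a using that by (auto simp: T_def)
  have "card T = nat (j div 2)" unfolding T_def by (subst card_image) (auto intro: inj_onI)
  then have "9 * int (card T) \<ge> M" using j assms by simp
  moreover have "T \<subseteq> {0..<M}" using T j by fastforce
  moreover have "\<not> M dvd a + b" if "a \<in> T" "b \<in> T" for a b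
    using T[OF that(1)] T[OF that(2)] j by (intro zdvd_not_zless) auto
  moreover have "\<not> M dvd a + b + c" "\<not> M dvd a + b - c" if "a \<in> T" "b \<in> T" "c \<in> T" for a b c
  proof -
    have "odd (a + b + c)" "odd (a + b - c)"
      using T(1)[OF that(1)] T(1)[OF that(2)] T(1)[OF that(3)] by simp_all
    then show "\<not> M dvd a + b + c" "\<not> M dvd a + b - c" using True dvd_trans by blast+
  qed
  ultimately show ?thesis using that by blast
next
  case False
  then obtain j where j: "M = 2 * j + 1" by (rule oddE)
  define T where "T = {M div 3 + 1..j}"
  have div3: "3 * (M div 3) \<le> M" "M < 3 * (M div 3 + 1)"
    using mult_div_mod_eq[of 3 M] pos_mod_bound[of 3 M] pos_mod_sign[of 3 M] by auto
  have T: "M < 3 * a" "2 * a < M" if "a \<in> T" for a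
    using that div3 j unfolding T_def atLeastAtMost_iff by linarith+
  \<comment> \<open>The size \<open>j - M div 3\<close> is at least \<open>(j - 1) / 3\<close>, and
    \<open>3 * (j - 1)\<close> reaches \<open>M = 2 * j + 1\<close> exactly from
    \<open>j = 4\<close> on. The remaining moduli 5 and 7 each leave a single residue.\<close>
  have "9 * int (card T) \<ge> M"
  proof (cases "j \<ge> 4")
    case True
    then show ?thesis using div3(1) j unfolding T_def by simp
  next
    case False
    then consider "j = 2" | "j = 3" using assms j by linarith
    then show ?thesis by cases (simp_all add: T_def j)
  qed
  moreover have "T \<subseteq> {0..<M}" using T assms by fastforce
  moreover have "\<not> M dvd a + b" if "a \<in> T" "b \<in> T" for a b
    using T[OF that(1)] T[OF that(2)] assms by (intro zdvd_not_zless) auto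
  moreover have "\<not> M dvd a + b + c" if "a \<in> T" "b \<in> T" "c \<in> T" for a b c
  proof -
    \<comment> \<open>Subtracting \<open>M\<close> brings the sum strictly between 0 and
      \<open>M\<close>.\<close>
    have "\<not> M dvd a + b + c - M"
      using T[OF that(1)] T[OF that(2)] T[OF that(3)] assms by (intro zdvd_not_zless) auto
    then show ?thesis by (meson dvd_diff dvd_refl)
  qed
  moreover have "\<not> M dvd a + b - c" if "a \<in> T" "b \<in> T" "c \<in> T" for a b c
    using T[OF that(1)] T[OF that(2)] T[OF that(3)] assms by (intro zdvd_not_zless) auto
  ultimately show ?thesis using that by blast
qed

section \<open>The lower bound \<open>n / 9\<close>\<close>

context comm_group
begin

lemma exists_3_independent:
  assumes fin: "finite (carrier G)" and g: "g \<in> carrier G" "ord g \<ge> 4"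
  obtains A where "t_independent G 3 A" "order G \<le> 9 * card A"
proof -
  obtain M f z where M: "M \<ge> int (ord g)" and f: "additive_mod M (carrier G) f"
    and z: "z \<in> carrier G" "[f z = 1] (mod M)"
    using surjective_character[OF fin g(1)] by blast
  have M4: "M \<ge> 4" using M g by simp
  obtain T where T: "T \<subseteq> {0..<M}" "9 * int (card T) \<ge> M"
    and two: "\<And>a b. a \<in> T \<Longrightarrow> b \<in> T \<Longrightarrow> \<not> M dvd a + b"
    and three: "\<And>a b c. a \<in> T \<Longrightarrow> b \<in> T \<Longrightarrow> c \<in> T \<Longrightarrow> \<not> M dvd a + b + c"
      "\<And>a b c. a \<in> T \<Longrightarrow> b \<in> T \<Longrightarrow> c \<in> T \<Longrightarrow> \<not> M dvd a + b - c"
    using residues_3_independent[OF M4] by blast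
  define A where "A = {x \<in> carrier G. f x mod M \<in> T}"
  have card_eq: "int (card A) * M = int (order G) * int (card T)"
    unfolding A_def by (rule card_character_preimage[OF fin f _ z T(1)]) (use M4 in simp)
  have "int (order G) * M \<le> int (order G) * (9 * int (card T))"
    using T(2) by (intro mult_left_mono) auto
  also have "\<dots> = (9 * int (card A)) * M" using card_eq by simp
  finally have le: "order G \<le> 9 * card A" using M4 by simp
  moreover have "order G > 0" using fin order_gt_0_iff_finite by simp
  ultimately have "A \<noteq> {}" by auto
  have f1: "M dvd f \<one>"
    using additive_mod_one[OF f subgroup_self] by (simp add: cong_0_iff)
  \<comment> \<open>Values of \<open>f\<close> are replaced by their representatives in
    \<open>T\<close>, so that a relation in \<open>A\<close> becomes a divisibility excluded by the
    choice of \<open>T\<close>.\<close>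
  have f2: "[f (a \<otimes> b) = f a mod M + f b mod M] (mod M)" if "a \<in> A" "b \<in> A" for a b
    using additive_modD[OF f, of a b] that by (simp add: A_def cong_def mod_simps)
  have f3: "[f (a \<otimes> b \<otimes> c) = f a mod M + f b mod M + f c mod M] (mod M)"
    if "a \<in> A" "b \<in> A" "c \<in> A" for a b c
  proof -
    have "[f (a \<otimes> b \<otimes> c) = f (a \<otimes> b) + f c] (mod M)"
      using that by (intro additive_modD[OF f]) (auto simp: A_def)
    also have "[f (a \<otimes> b) + f c = f a mod M + f b mod M + f c mod M] (mod M)"
      by (rule cong_add[OF f2[OF that(1,2)]]) (simp add: cong_def)
    finally show ?thesis .
  qed
  have "t_independent G 3 A"
    unfolding t_independent_3_iff
  proof (intro conjI ballI)
    show "A \<subseteq> carrier G" "finite A" "A \<noteq> {}" using fin \<open>A \<noteq> {}\<close> by (auto simp: A_def)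
    fix a b assume ab: "a \<in> A" "b \<in> A"
    show "a \<otimes> b \<noteq> \<one>"
      using f2[OF ab] f1 two ab by (auto simp: A_def cong_dvd_iff)
    fix c assume c: "c \<in> A"
    show "a \<otimes> b \<otimes> c \<noteq> \<one>"
      using f3[OF ab c] f1 three(1) ab c by (auto simp: A_def cong_dvd_iff)
    show "a \<otimes> b \<noteq> c"
    proof
      assume "a \<otimes> b = c"
      then have "[f a mod M + f b mod M = f c mod M] (mod M)"
        using f2[OF ab] by (simp add: cong_def)
      then have "M dvd f a mod M + f b mod M - f c mod M" by (simp only: cong_iff_dvd_diff)
      then show False using three(2) ab c by (auto simp: A_def)
    qed
  qed
  then show ?thesis using that le by blast
qed

section \<open>Elementary abelian groups and element orders\<close>

lemma iso_elementary_abelian_pow: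
  assumes "iso_elementary_abelian p G" "x \<in> carrier G"
  shows "x [^] p = \<one>"
proof -
  obtain H :: "'a monoid" and h where H: "comm_group H"
      "\<And>y. y \<in> carrier H \<Longrightarrow> y \<noteq> \<one>\<^bsub>H\<^esub> \<Longrightarrow> group.ord H y = p" and h: "h \<in> iso G H"
    using assms(1) unfolding iso_elementary_abelian_def elementary_abelian_def is_iso_def by blast
  interpret H: comm_group H by (rule H(1))
  interpret h: group_hom G H h
    using h by unfold_locales (auto simp: iso_def)
  have "h x [^]\<^bsub>H\<^esub> p = \<one>\<^bsub>H\<^esub>"
    using H(2)[of "h x"] assms(2) H.pow_ord_eq_1[of "h x"] by (cases "h x = \<one>\<^bsub>H\<^esub>") auto
  then have "h (x [^] p) = h \<one>" using assms(2) by (simp add: h.hom_nat_pow)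
  then show ?thesis
    using h assms(2) by (auto simp: iso_def bij_betw_def inj_on_def)
qed

lemma not_iso_elementary_abelianE:
  assumes "\<not> iso_elementary_abelian p G" "Factorial_Ring.prime p"
  obtains x where "x \<in> carrier G" "x \<noteq> \<one>" "ord x \<noteq> p"
proof (rule ccontr)
  assume "\<not> thesis"
  then have all: "\<And>x. x \<in> carrier G \<Longrightarrow> x \<noteq> \<one> \<Longrightarrow> ord x = p" using that by blast
  \<comment> \<open>\<open>G\<close> may carry extra record fields while the definition asks for a
    plain monoid; truncation drops the fields, and the identity map is an isomorphism.\<close>
  define H where "H = monoid.truncate G"
  have H: "carrier H = carrier G" "monoid.mult H = monoid.mult G" "one H = one G"
    by (simp_all add: H_def monoid.truncate_def)
  have "(\<lambda>x. x) \<in> iso G H" by (auto simp: iso_def hom_def H bij_betw_def)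
  moreover have "comm_group H"
    by (rule comm_groupI) (auto simp: H m_ac intro: l_inv_ex)
  moreover from this have "group.ord H = ord"
    by (simp add: fun_eq_iff group.ord_def[OF comm_group.axioms(2)] group.ord_def[OF is_group]
        nat_pow_def H)
  ultimately have "elementary_abelian p H" "G \<cong> H"
    using all assms(2) unfolding elementary_abelian_def is_iso_def by (auto simp: H)
  then show False using assms(1) unfolding iso_elementary_abelian_def by blast
qed

text \<open>If all orders were at most 3, failure of both exponents would give an \<open>x\<close>
  of order 3 and a \<open>y\<close> of order 2. Their product has nontrivial square and cube, so its
  order is neither 2 nor 3.\<close>

lemma exists_ord_ge_4:
  assumes fin: "finite (carrier G)"
    and "\<not> iso_elementary_abelian 2 G" "\<not> iso_elementary_abelian 3 G"
  obtains g where "g \<in> carrier G" "ord g \<ge> 4"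
proof (rule ccontr)
  assume "\<not> thesis"
  then have "\<not> (g \<in> carrier G \<and> 4 \<le> ord g)" for g using that by blast
  then have small: "ord g < 4" if "g \<in> carrier G" for g using that by force
  have cases: "ord g = 2 \<or> ord g = 3" if "g \<in> carrier G" "g \<noteq> \<one>" for g
    using small[OF that(1)] ord_ge_1[OF fin that(1)] ord_eq_1[OF that(1)] that(2) by linarith
  obtain x where x: "x \<in> carrier G" "x \<noteq> \<one>" "ord x \<noteq> 2"
    using not_iso_elementary_abelianE[OF assms(2)] by auto
  obtain y where y: "y \<in> carrier G" "y \<noteq> \<one>" "ord y \<noteq> 3"
    using not_iso_elementary_abelianE[OF assms(3)] by auto
  have ords: "ord x = 3" "ord y = 2" using cases x y by blast+
  have "(x \<otimes> y) [^] (2::nat) = x [^] (2::nat)"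
    using x y pow_ord_eq_1[OF y(1)] ords by (simp add: pow_mult_distrib m_comm)
  then have sq: "(x \<otimes> y) [^] (2::nat) \<noteq> \<one>"
    using pow_eq_id[OF x(1), of 2] ords by (auto dest: dvd_imp_le)
  have "(x \<otimes> y) [^] (3::nat) = y [^] (3::nat)"
    using x y pow_ord_eq_1[OF x(1)] ords by (simp add: pow_mult_distrib m_comm)
  then have cube: "(x \<otimes> y) [^] (3::nat) \<noteq> \<one>"
    using pow_eq_id[OF y(1), of 3] ords by auto
  have xy: "x \<otimes> y \<in> carrier G" using x y by simp
  have "x \<otimes> y \<noteq> \<one>" using sq by auto
  then show False using cases[OF xy] sq cube pow_ord_eq_1[OF xy] by metis
qed

section \<open>The largest size of an independent set\<close>

lemma max_indep_eq_0:
  "(\<And>A. \<not> t_independent G t A) \<Longrightarrow> max_indep G t = 0"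
  by (simp add: max_indep_def)

lemma max_indep_eq_Max:
  assumes "finite (carrier G)" "t_independent G t A"
  shows "finite (card ` {A. t_independent G t A})"
    and "max_indep G t = Max (card ` {A. t_independent G t A})"
proof -
  have "{A. t_independent G t A} \<subseteq> Pow (carrier G)" by (auto simp: t_independent_def)
  then show "finite (card ` {A. t_independent G t A})"
    using assms(1) by (meson finite_Pow_iff finite_imageI finite_subset)
  have "{card A | A. t_independent G t A} = card ` {A. t_independent G t A}" by blast
  moreover have "\<exists>A. t_independent G t A" using assms(2) by blast
  ultimately show "max_indep G t = Max (card ` {A. t_independent G t A})"
    by (simp only: max_indep_def if_True)
qed

lemma card_le_max_indep:
  assumes "finite (carrier G)" "t_independent G t A"
  shows "card A \<le> max_indep G t"
  using max_indep_eq_Max[OF assms] assms(2) by auto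

lemma max_indep_attained:
  assumes "finite (carrier G)" "t_independent G t A"
  obtains B where "t_independent G t B" "max_indep G t = card B"
proof -
  have "max_indep G t \<in> card ` {A. t_independent G t A}"
    unfolding max_indep_eq_Max(2)[OF assms]
    by (rule Max_in) (use max_indep_eq_Max(1)[OF assms] assms(2) in auto)
  then show ?thesis using that by blast
qed

end

section \<open>Combination of the two cases\<close>

theorem theorem6:
  fixes G :: "('a, 'b) monoid_scheme" and n :: nat
  assumes "comm_group G" and "finite (carrier G)" and "order G = n" and "n \<ge> 2"
  shows "(iso_elementary_abelian 2 G \<or> iso_elementary_abelian 3 G \<longrightarrow> max_indep G 3 = 0) \<and>
         (\<not> (iso_elementary_abelian 2 G \<or> iso_elementary_abelian 3 G) \<longrightarrow>
            1 / 9 * real n \<le> real (max_indep G 3) \<and> real (max_indep G 3) \<le> 1 / 4 * real n)"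
proof -
  interpret comm_group G by (rule assms(1))
  have "max_indep G 3 = 0" if el: "iso_elementary_abelian 2 G \<or> iso_elementary_abelian 3 G"
  proof (rule max_indep_eq_0)
    fix A
    show "\<not> t_independent G 3 A"
    proof
      assume A: "t_independent G 3 A"
      then obtain a where a: "a \<in> A" "a \<in> carrier G" unfolding t_independent_3_iff by blast
      \<comment> \<open>Any single element already violates independence: its square or its cube is
        the identity.\<close>
      have "a [^]\<^bsub>G\<^esub> (2::nat) = a \<otimes>\<^bsub>G\<^esub> a"
        "a [^]\<^bsub>G\<^esub> (3::nat) = a \<otimes>\<^bsub>G\<^esub> a \<otimes>\<^bsub>G\<^esub> a"
        using a(2) by (simp_all add: numeral_2_eq_2 numeral_3_eq_3)
      then have "a \<otimes>\<^bsub>G\<^esub> a = \<one>\<^bsub>G\<^esub> \<or> a \<otimes>\<^bsub>G\<^esub> a \<otimes>\<^bsub>G\<^esub> a = \<one>\<^bsub>G\<^esub>"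
        using el iso_elementary_abelian_pow[OF _ a(2)] by metis
      then show False using A a(1) unfolding t_independent_3_iff by blast
    qed
  qed
  moreover have "1 / 9 * real n \<le> real (max_indep G 3) \<and> real (max_indep G 3) \<le> 1 / 4 * real n"
    if not_el: "\<not> (iso_elementary_abelian 2 G \<or> iso_elementary_abelian 3 G)"
  proof -
    obtain g where "g \<in> carrier G" "ord g \<ge> 4" using exists_ord_ge_4[OF assms(2)] not_el by blast
    then obtain A where A: "t_independent G 3 A" "order G \<le> 9 * card A"
      using exists_3_independent[OF assms(2)] by blast
    \<comment> \<open>The set \<open>A\<close> only bounds the maximum from below; the upper bound
      is applied to a set \<open>B\<close> attaining it.\<close>
    obtain B where B: "t_independent G 3 B" "max_indep G 3 = card B"
      using max_indep_attained[OF assms(2) A(1)] by blast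
    have "n \<le> 9 * max_indep G 3"
      using A card_le_max_indep[OF assms(2) A(1)] assms(3) by linarith
    moreover have "4 * max_indep G 3 \<le> n"
      using t_independent_3_card_le[OF assms(2) B(1)] B(2) assms(3) by simp
    ultimately show ?thesis by linarith
  qed
  ultimately show ?thesis by blast
qed

end
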